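(* Let $\ell\ge 1$ be a fixed integer and let $L$ be a fixed integer with $L\ge 2^\ell$. Then there exist $n_0$ and $A$ (depending only on $\ell$ and $L$) such that for every integer $n\ge n_0$ and $r=\lfloor n/2\rfloor-L$, $$M_r^{(\le\ell)}(n)\le A\,n^{2^{\ell-1}+1}.$$
   Context: Let $\mathbb{F}=\{0,1\}$ and let $\mathbb{F}^n$ be the binary Hamming space (hypercube), with Hamming distance $d(x,y)$ = number of coordinates in which $x$ and $y$ differ. For $x\in\mathbb{F}^n$ put $B_r(x)=\{y\in\mathbb{F}^n: d(x,y)\le r\}$, and for $X\subseteq\mathbb{F}^n$ put $B_r(X)=\bigcup_{x\in X}B_r(x)$. A code is a nonempty subset $C\subseteq\mathbb{F}^n$; write $I_r(C;X)=B_r(X)\cap C$ (so $I_r(C;\emptyset)=\emptyset$). For non-negative integers $r,\ell$, a code $C\subseteq\mathbb{F}^n$ is $(r,\le\ell)$-identifying if $I_r(C;X)\ne I_r(C;Y)$ for all $X,Y\subseteq\mathbb{F}^n$ with $|X|\le\ell$, $|Y|\le\ell$ and $X\neq Y$ (the empty set is allowed as $X$ or $Y$). $M_r^{(\le\ell)}(n)$ denotes the smallest possible cardinality of an $(r,\le\ell)$-identifying code in $\mathbb{F}^n$; a bound $M_r^{(\le\ell)}(n)\le K$ means that an $(r,\le\ell)$-identifying code in $\mathbb{F}^n$ of size at most $K$ exists. *)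

theory Defs
  imports "HOL-Library.FuncSet" "HOL-Library.Extended_Real"
begin

text \<open>Words of length \<open>n\<close> are extensional functions on the coordinate set \<open>{..<n}\<close>, so that two
  words are equal iff they agree in all \<open>n\<close> coordinates.\<close>

definition hamming_space :: "nat \<Rightarrow> (nat \<Rightarrow> bool) set" where
  "hamming_space n = ({..<n} \<rightarrow>\<^sub>E (UNIV :: bool set))"

definition hamming_dist :: "nat \<Rightarrow> (nat \<Rightarrow> bool) \<Rightarrow> (nat \<Rightarrow> bool) \<Rightarrow> nat" where
  "hamming_dist n x y = card {i \<in> {..<n}. x i \<noteq> y i}"

definition hamming_ball :: "nat \<Rightarrow> nat \<Rightarrow> (nat \<Rightarrow> bool) \<Rightarrow> (nat \<Rightarrow> bool) set" where
  "hamming_ball n r x = {y \<in> hamming_space n. hamming_dist n x y \<le> r}"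

definition I_set :: "nat \<Rightarrow> nat \<Rightarrow> (nat \<Rightarrow> bool) set \<Rightarrow> (nat \<Rightarrow> bool) set \<Rightarrow> (nat \<Rightarrow> bool) set" where
  "I_set n r C X = (\<Union>x\<in>X. hamming_ball n r x) \<inter> C"

definition is_code :: "nat \<Rightarrow> (nat \<Rightarrow> bool) set \<Rightarrow> bool" where
  "is_code n C \<longleftrightarrow> C \<subseteq> hamming_space n \<and> C \<noteq> {}"

definition identifying :: "nat \<Rightarrow> nat \<Rightarrow> nat \<Rightarrow> (nat \<Rightarrow> bool) set \<Rightarrow> bool" where
  "identifying n r l C \<longleftrightarrow> is_code n C \<and>
     (\<forall>X Y. X \<subseteq> hamming_space n \<and> Y \<subseteq> hamming_space n \<and> card X \<le> l \<and> card Y \<le> l \<and> X \<noteq> Y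
        \<longrightarrow> I_set n r C X \<noteq> I_set n r C Y)"

text \<open>The minimum is taken in the extended naturals and is \<open>\<infinity>\<close> if there is no identifying code;
  hence an upper bound on it entails that such a code exists.\<close>

definition min_identifying :: "nat \<Rightarrow> nat \<Rightarrow> nat \<Rightarrow> enat" where
  "min_identifying r l n = (INF C \<in> {C. identifying n r l C}. enat (card C))"

lemma min_identifying_le_iff:
  fixes K :: real
  shows "ereal_of_enat (min_identifying r l n) \<le> ereal K
    \<longleftrightarrow> (\<exists>C. identifying n r l C \<and> real (card C) \<le> K)"
proof
  assume le: "ereal_of_enat (min_identifying r l n) \<le> ereal K"
  let ?S = "(\<lambda>C. enat (card C)) ` {C. identifying n r l C}"
  have "?S \<noteq> {}"
  proof
    assume "?S = {}"
    then have "min_identifying r l n = \<infinity>"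
      by (simp only: min_identifying_def Inf_enat_def simp_thms if_True)
    with le show False by simp
  qed
  then have "Inf ?S \<in> ?S"
    by (auto simp: Inf_enat_def intro: LeastI)
  then obtain C where "identifying n r l C" "min_identifying r l n = enat (card C)"
    unfolding min_identifying_def by auto
  with le show "\<exists>C. identifying n r l C \<and> real (card C) \<le> K" by auto
next
  assume "\<exists>C. identifying n r l C \<and> real (card C) \<le> K"
  then obtain C where C: "identifying n r l C" "real (card C) \<le> K" by blast
  have "min_identifying r l n \<le> enat (card C)"
    unfolding min_identifying_def using C(1) by (intro INF_lower) simp
  then have "ereal_of_enat (min_identifying r l n) \<le> ereal_of_enat (enat (card C))"
    by (simp only: ereal_of_enat_le_iff)
  also have "\<dots> \<le> ereal K" using C(2) by simp
  finally show "ereal_of_enat (min_identifying r l n) \<le> ereal K" .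
qed

end

theory Submission
  imports Defs
begin

text \<open>Identifying all pairs amounts to hitting every set \<open>B\<^sub>r(x) - B\<^sub>r(Y)\<close> with \<open>x \<notin> Y\<close> and
  \<open>|Y| \<le> \<ell>\<close>. Partition the coordinates into at most \<open>2^\<ell>\<close> classes \<open>p\<close> according to
  which \<open>y \<in> Y\<close> differ from \<open>x\<close> there. A word \<open>z\<close> differing from \<open>x\<close> in exactly \<open>r\<close>
  coordinates, but in strictly less than half of each nonempty class, is nearer to \<open>x\<close> than to
  every \<open>y\<close>. Taking \<open>(m - 1) div 2\<close> coordinates of each class of size \<open>m\<close> gives a total
  weight between \<open>n/2 - 2^\<ell>\<close> and \<open>n/2\<close>, so (as \<open>L \<ge> 2^\<ell>\<close>) the weight \<open>r\<close> is reached by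
  removing at most \<open>L\<close> further coordinates from a largest class. Each class contributes a nearly
  central binomial coefficient, of order at least \<open>2^m / sqrt n\<close>, so a proportion of order
  \<open>n powr -2^(\<ell> - 1)\<close> of all words is suitable. A greedy choice then hits all the
  \<open>2^O(n)\<close> sets; this costs the additional factor \<open>n\<close>.\<close>

section \<open>Nearly central binomial coefficients\<close>

text \<open>Consecutive central binomials have ratio \<open>2 * (2 * n + 1) / (n + 1)\<close>. Since
  \<open>4 * n * (n + 1) \<le> (2 * n + 1) ^ 2\<close>, the quantity
  \<open>n * ((2 * n) choose n) ^ 2 / 16 ^ n\<close> never decreases, and at \<open>n = 1\<close>
  the bound is an equality. Squaring keeps square roots out of the induction.\<close>

lemma central_binomial_sq_lower:
  assumes "n \<ge> 1"
  shows "(16::real) ^ n \<le> 4 * real n * real ((2 * n) choose n) ^ 2"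
  using assms
proof (induction n rule: nat_induct_at_least)
  case base
  show ?case by (simp add: numeral_2_eq_2)
next
  case (Suc n)
  let ?a = "real ((2 * n) choose n)" and ?b = "real ((2 * Suc n) choose Suc n)"
  have "Suc n * (Suc (2 * n) choose Suc n) = Suc (2 * n) * ((2 * n) choose n)"
    by (rule Suc_times_binomial)
  moreover have "Suc (2 * n) choose Suc n = Suc (2 * n) choose n"
    using binomial_symmetric[of n "Suc (2 * n)"] by simp
  then have "(2 * Suc n) choose Suc n = 2 * (Suc (2 * n) choose Suc n)" by simp
  ultimately have "Suc n * ((2 * Suc n) choose Suc n) = 2 * (Suc (2 * n) * ((2 * n) choose n))"
    by (simp only: mult.left_commute)
  then have "real (Suc n) * ?b = 2 * (real (Suc (2 * n)) * ?a)"
    by (simp only: of_nat_mult[symmetric] of_nat_numeral[symmetric, where ?'a = real])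
  moreover have "real (Suc n) = real n + 1" "real (Suc (2 * n)) = 2 * real n + 1" by simp_all
  ultimately have eq: "(real n + 1) * ?b = 2 * ((2 * real n + 1) * ?a)" by (simp only:)
  have "(real n + 1) * (16 * 16 ^ n) \<le> (real n + 1) * (16 * (4 * real n * ?a ^ 2))"
    using Suc.IH by (intro mult_left_mono) auto
  also have "\<dots> = 16 * (4 * real n * (real n + 1)) * ?a ^ 2" by simp
  also have "\<dots> \<le> 16 * (2 * real n + 1) ^ 2 * ?a ^ 2"
    by (intro mult_right_mono mult_left_mono) (auto simp: power2_eq_square algebra_simps)
  also have "\<dots> = 4 * (2 * ((2 * real n + 1) * ?a)) ^ 2"
    by (simp add: power_mult_distrib)
  also have "\<dots> = (real n + 1) * (4 * (real n + 1) * ?b ^ 2)"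
    unfolding eq[symmetric] by (simp add: power2_eq_square)
  finally have "16 * 16 ^ n \<le> 4 * (real n + 1) * ?b ^ 2"
    by (simp only: mult_le_cancel_left_pos[of "real n + 1"] of_nat_0_le_iff add_nonneg_pos zero_less_one)
  then show ?case by (simp add: add.commute)
qed

lemma central_binomial_sqrt_lower:
  assumes "n \<ge> 1"
  shows "(4::real) ^ n \<le> 2 * sqrt n * real ((2 * n) choose n)"
proof (rule power2_le_imp_le)
  have "((4::real) ^ n) ^ 2 = 16 ^ n"
    by (simp add: power2_eq_square power_mult_distrib[symmetric])
  also have "\<dots> \<le> 4 * real n * real ((2 * n) choose n) ^ 2"
    using assms by (rule central_binomial_sq_lower)
  also have "\<dots> = (2 * sqrt n * real ((2 * n) choose n)) ^ 2"
    by (simp add: power_mult_distrib)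
  finally show "((4::real) ^ n) ^ 2 \<le> (2 * sqrt n * real ((2 * n) choose n)) ^ 2" .
qed simp

text \<open>Bounding by \<open>N\<close> instead of \<open>m\<close> gives all classes of a
  partition, empty ones included, the same factor.\<close>

lemma middle_binomial_lower:
  assumes "m \<le> N" "N \<ge> 1"
  shows "(2::real) ^ m \<le> 2 * sqrt N * real (m choose (m div 2))"
proof (cases "m = 0")
  case True
  have "1 \<le> sqrt (real N)" using assms by simp
  then have "1 \<le> 2 * sqrt (real N)" by linarith
  with True show ?thesis by simp
next
  case False
  show ?thesis
  proof (cases "even m")
    case True
    then obtain k where k: "m = 2 * k" by blast
    have "(2::real) ^ m = 4 ^ k" by (simp add: k power_mult)
    also have "\<dots> \<le> 2 * sqrt k * real ((2 * k) choose k)"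
      using False k by (intro central_binomial_sqrt_lower) simp
    also have "\<dots> \<le> 2 * sqrt N * real ((2 * k) choose k)"
      using assms k by (intro mult_right_mono) auto
    finally show ?thesis using k by simp
  next
    case odd: False
    then obtain k where k: "m = Suc (2 * k)" using oddE by (metis Suc_eq_plus1)
    \<comment> \<open>An odd row reduces to the next even one: by Pascal's rule and symmetry its
      central entry is twice \<open>m choose k\<close>.\<close>
    have "(2 * Suc k) choose Suc k = (Suc (2 * k) choose k) + (Suc (2 * k) choose Suc k)"
      by simp
    also have "Suc (2 * k) choose Suc k = Suc (2 * k) choose k"
      using binomial_symmetric[of k "Suc (2 * k)"] by simp
    finally have b: "(2 * Suc k) choose Suc k = 2 * (m choose k)" using k by simp
    have "2 * (2::real) ^ m = 4 ^ Suc k" by (simp add: k power_mult)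
    also have "\<dots> \<le> 2 * sqrt (Suc k) * real ((2 * Suc k) choose Suc k)"
      by (intro central_binomial_sqrt_lower) simp
    also have "\<dots> \<le> 2 * sqrt N * real ((2 * Suc k) choose Suc k)"
      using assms k by (intro mult_right_mono) auto
    finally have "2 * (2::real) ^ m \<le> 2 * (2 * sqrt N * real (m choose k))"
      unfolding b by simp
    then show ?thesis using k by simp
  qed
qed

text \<open>The ratio of the two coefficients is \<open>(m - k) / (k + 1)\<close>, and the
  hypothesis says exactly that \<open>m - k \<le> 4 * (k + 1)\<close>.\<close>

lemma binomial_Suc_le:
  assumes "m \<le> 5 * k + 4"
  shows "m choose Suc k \<le> 4 * (m choose k)"
proof -
  have "Suc k * (m choose Suc k) = (m - k) * (m choose k)"
    by (metis binomial_absorb_comp binomial_absorption mult.commute)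
  also have "\<dots> \<le> (Suc k * 4) * (m choose k)"
    using assms by (intro mult_right_mono) auto
  finally have "Suc k * (m choose Suc k) \<le> Suc k * (4 * (m choose k))" by (simp only: mult.assoc)
  then show ?thesis by (simp only: Suc_mult_le_cancel1)
qed

lemma binomial_shift_le:
  assumes "m \<le> 5 * k + 4"
  shows "m choose (k + D) \<le> 4 ^ D * (m choose k)"
proof (induction D)
  case (Suc D)
  have "m choose (k + Suc D) \<le> 4 * (m choose (k + D))"
    using assms binomial_Suc_le[of m "k + D"] by simp
  with Suc show ?case by simp
qed simp

text \<open>The index lies at most \<open>L + 1\<close> places below \<open>m div 2\<close>: up to
  \<open>D\<close> from the shift, and one more if \<open>m\<close> is even. Each place costs a
  factor 4, so the constant is \<open>2 * 4 ^ (L + 1)\<close>. The condition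
  \<open>m \<ge> 10 * D\<close> keeps the index high enough for this ratio bound.\<close>

lemma near_middle_binomial_lower:
  assumes "m \<le> N" "N \<ge> 1" "D = 0 \<or> m \<ge> 10 * D" "D \<le> L"
  shows "(2::real) ^ m \<le> 8 * 4 ^ L * sqrt N * real (m choose ((m - 1) div 2 - D))"
proof -
  define k where "k = (m - 1) div 2 - D"
  obtain E where E: "m div 2 = k + E" "E \<le> Suc L"
  proof
    show "m div 2 = k + (m div 2 - k)" "m div 2 - k \<le> Suc L"
      using assms unfolding k_def by auto
  qed
  have "m \<le> 5 * k + 4" using assms unfolding k_def by auto
  then have "m choose (m div 2) \<le> 4 ^ E * (m choose k)"
    unfolding E(1) by (rule binomial_shift_le)
  also have "\<dots> \<le> 4 ^ Suc L * (m choose k)"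
    using E(2) by (intro mult_right_mono power_increasing) auto
  finally have *: "real (m choose (m div 2)) \<le> 4 ^ Suc L * real (m choose k)"
    by (metis of_nat_le_iff of_nat_mult of_nat_numeral of_nat_power)
  have "(2::real) ^ m \<le> 2 * sqrt N * real (m choose (m div 2))"
    using assms by (intro middle_binomial_lower)
  also have "\<dots> \<le> 2 * sqrt N * (4 ^ Suc L * real (m choose k))"
    using * by (intro mult_left_mono) auto
  also have "\<dots> = 8 * 4 ^ L * sqrt N * real (m choose k)" by simp
  finally show ?thesis unfolding k_def .
qed

section \<open>Counting by classes\<close>

lemma card_eq_sum_fibres:
  assumes "finite A" "finite I" "f ` A \<subseteq> I"
  shows "card A = (\<Sum>p\<in>I. card {j \<in> A. f j = p})"
proof -
  have "card A = card (\<Union>p\<in>I. {j \<in> A. f j = p})"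
    using assms(3) by (intro arg_cong[where f = card]) auto
  also have "\<dots> = (\<Sum>p\<in>I. card {j \<in> A. f j = p})"
    using assms by (intro card_UN_disjoint) auto
  finally show ?thesis .
qed

text \<open>Subsets of the fibres are chosen independently and united; intersecting the union with a
  fibre recovers the choice there. Only an inequality holds, because \<open>f\<close> may take
  values outside \<open>I\<close>, where \<open>S\<close> is unrestricted.\<close>

lemma card_subsets_by_fibres_ge:
  assumes "finite A" "finite I"
  shows "(\<Prod>p\<in>I. card {j \<in> A. f j = p} choose w p)
    \<le> card {S. S \<subseteq> A \<and> (\<forall>p\<in>I. card {j \<in> S. f j = p} = w p)}"
proof -
  define F where "F p = {T. T \<subseteq> {j \<in> A. f j = p} \<and> card T = w p}" for p
  have mem: "T p \<subseteq> {j \<in> A. f j = p}" "card (T p) = w p" if "T \<in> Pi\<^sub>E I F" "p \<in> I" for T p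
    using PiE_mem[OF that] unfolding F_def by simp_all
  have fibre: "{j \<in> (\<Union>q\<in>I. T q). f j = p} = T p" if T: "T \<in> Pi\<^sub>E I F" and p: "p \<in> I" for T p
    using mem(1)[OF T] p by fast
  have "(\<Prod>p\<in>I. card {j \<in> A. f j = p} choose w p) = card (Pi\<^sub>E I F)"
    using assms by (simp add: card_PiE F_def n_subsets)
  also have "\<dots> \<le> card {S. S \<subseteq> A \<and> (\<forall>p\<in>I. card {j \<in> S. f j = p} = w p)}"
  proof (rule card_inj_on_le)
    show "inj_on (\<lambda>T. \<Union>q\<in>I. T q) (Pi\<^sub>E I F)"
    proof (rule inj_onI)
      fix T T' assume T: "T \<in> Pi\<^sub>E I F" "T' \<in> Pi\<^sub>E I F" and eq: "(\<Union>q\<in>I. T q) = (\<Union>q\<in>I. T' q)"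
      show "T = T'"
        using T
      proof (rule PiE_ext)
        fix p assume p: "p \<in> I"
        show "T p = T' p" using fibre[OF T(1) p] fibre[OF T(2) p] by (simp only: eq)
      qed
    qed
    show "(\<lambda>T. \<Union>q\<in>I. T q) ` Pi\<^sub>E I F \<subseteq> {S. S \<subseteq> A \<and> (\<forall>p\<in>I. card {j \<in> S. f j = p} = w p)}"
    proof (intro image_subsetI CollectI conjI ballI)
      fix T assume T: "T \<in> Pi\<^sub>E I F"
      show "(\<Union>q\<in>I. T q) \<subseteq> A" using mem(1)[OF T] by blast
      fix p assume p: "p \<in> I"
      show "card {j \<in> (\<Union>q\<in>I. T q). f j = p} = w p" by (simp only: fibre[OF T p] mem(2)[OF T p])
    qed
    show "finite {S. S \<subseteq> A \<and> (\<forall>p\<in>I. card {j \<in> S. f j = p} = w p)}"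
      using assms by simp
  qed
  finally show ?thesis .
qed

lemma fibre_weights_exist:
  fixes m :: "'a \<Rightarrow> nat"
  assumes fin: "finite I" and ne: "I \<noteq> {}" and L: "card I \<le> L" and sum: "(\<Sum>p\<in>I. m p) = n"
    and n: "n \<ge> card I * (10 * L + 10)"
  shows "\<exists>w. (\<Sum>p\<in>I. w p) = n div 2 - L \<and> (\<forall>p\<in>I.
    w p \<le> m p - w p \<and> (m p > 0 \<longrightarrow> w p < m p - w p) \<and>
    (\<forall>N\<ge>1. m p \<le> N \<longrightarrow> (2::real) ^ m p \<le> 8 * 4 ^ L * sqrt N * real (m p choose w p)))"
proof -
  \<comment> \<open>For a nonempty class this is the largest integer strictly below
    \<open>m p / 2\<close>; for an empty class truncated subtraction gives 0.\<close>
  define b where "b p = (m p - 1) div 2" for p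
  \<comment> \<open>Pigeonhole: some class has at least average size, enough to absorb the whole
    correction \<open>D\<close> alone.\<close>
  have "\<exists>q\<in>I. m q \<ge> 10 * L + 10"
  proof (rule ccontr)
    assume "\<not> ?thesis"
    then have "(\<Sum>p\<in>I. m p) < (\<Sum>p\<in>I. 10 * L + 10)"
      using fin ne by (intro sum_strict_mono) (auto simp: not_le)
    with n sum show False by simp
  qed
  then obtain q where q: "q \<in> I" "m q \<ge> 10 * L + 10" by blast
  \<comment> \<open>Rounding loses at most 1 from \<open>m p / 2\<close> in each class, so
    \<open>card I \<le> L\<close> ensures that the total of \<open>b\<close> does not fall below
    \<open>n div 2 - L\<close>. Hence the subtraction defining \<open>D\<close> is exact.\<close>
  have "n \<le> (\<Sum>p\<in>I. 2 * b p + 2)"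
    unfolding sum[symmetric] by (rule sum_mono) (simp add: b_def)
  also have "\<dots> = 2 * (\<Sum>p\<in>I. b p) + 2 * card I"
    by (simp only: sum.distrib sum_distrib_left sum_constant) simp
  finally have low: "n \<le> 2 * (\<Sum>p\<in>I. b p) + 2 * L" using L by simp
  have "2 * (\<Sum>p\<in>I. b p) \<le> n"
    unfolding sum[symmetric] sum_distrib_left by (rule sum_mono) (simp add: b_def)
  define D where "D = (\<Sum>p\<in>I. b p) - (n div 2 - L)"
  have D: "D \<le> L" "(\<Sum>p\<in>I. b p) = n div 2 - L + D"
    using low \<open>2 * (\<Sum>p\<in>I. b p) \<le> n\<close> unfolding D_def by auto
  define w where "w p = b p - (if p = q then D else 0)" for p
  have Dq: "D \<le> b q" using q D unfolding b_def by auto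
  have "(\<Sum>p\<in>I. b p) = (\<Sum>p\<in>I. w p + (if p = q then D else 0))"
    using Dq by (intro sum.cong) (auto simp: w_def)
  also have "\<dots> = (\<Sum>p\<in>I. w p) + D" using q fin by (simp add: sum.distrib)
  finally have w: "(\<Sum>p\<in>I. w p) = n div 2 - L" using D by simp
  show ?thesis
  proof (intro exI[of _ w] conjI ballI allI impI w)
    fix p assume "p \<in> I"
    show "w p \<le> m p - w p" unfolding w_def b_def by auto
    show "w p < m p - w p" if "m p > 0" using that unfolding w_def b_def by auto
    show "(2::real) ^ m p \<le> 8 * 4 ^ L * sqrt N * real (m p choose w p)"
      if "m p \<le> N" "N \<ge> 1" for N
      unfolding w_def b_def using that D q by (intro near_middle_binomial_lower) auto
  qed
qed

section \<open>Private neighbourhoods\<close>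

lemma finite_hamming_space: "finite (hamming_space n)"
  unfolding hamming_space_def by (simp add: finite_PiE)

lemma card_hamming_space: "card (hamming_space n) = 2 ^ n"
  unfolding hamming_space_def by (simp add: card_PiE)

text \<open>Addition of the indicator of \<open>S\<close> modulo 2: on booleans
  \<open>\<noteq>\<close> is exclusive or. For \<open>S \<subseteq> {..<n}\<close> the result
  differs from \<open>x\<close> exactly on \<open>S\<close>.\<close>

definition flip :: "nat \<Rightarrow> (nat \<Rightarrow> bool) \<Rightarrow> nat set \<Rightarrow> (nat \<Rightarrow> bool)" where
  "flip n x S = (\<lambda>j\<in>{..<n}. x j \<noteq> (j \<in> S))"

lemma flip_in_hamming_space: "flip n x S \<in> hamming_space n"
  unfolding flip_def hamming_space_def by simp

lemma inj_on_flip: "inj_on (flip n x) (Pow {..<n})"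
proof (rule inj_onI)
  fix S T assume ST: "S \<in> Pow {..<n}" "T \<in> Pow {..<n}" and eq: "flip n x S = flip n x T"
  have "j \<in> S \<longleftrightarrow> j \<in> T" if "j < n" for j
    using fun_cong[OF eq, of j] that by (auto simp: flip_def)
  with ST show "S = T" by blast
qed

text \<open>Private neighbours are counted by their difference sets from \<open>x\<close>, with a
  prescribed weight in each class. The base of the power is the loss per class in the binomial
  bound, and there are at most \<open>2 ^ l\<close> classes.\<close>

lemma card_private_neighbours_ge:
  assumes x: "x \<in> hamming_space n" and Y: "Y \<subseteq> hamming_space n" "x \<notin> Y" "card Y \<le> l"
    and L: "L \<ge> 2 ^ l" and n: "n \<ge> 2 ^ l * (10 * L + 10)"
  shows "(2::real) ^ n \<le> (8 * 4 ^ L * sqrt n) ^ 2 ^ l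
    * real (card (hamming_ball n (n div 2 - L) x - (\<Union>y\<in>Y. hamming_ball n (n div 2 - L) y)))"
proof -
  define r where "r = n div 2 - L"
  \<comment> \<open>Classes are indexed by all subsets of \<open>Y\<close>; those that do not occur
    are empty and have \<open>m p = 0\<close>.\<close>
  define I where "I = Pow Y"
  define f where "f j = {y \<in> Y. y j \<noteq> x j}" for j
  define m where "m p = card {j \<in> {..<n}. f j = p}" for p
  have finY: "finite Y" using Y finite_hamming_space finite_subset by blast
  then have fin: "finite I" by (simp add: I_def)
  have ne: "I \<noteq> {}" unfolding I_def by blast
  have cardI: "card I \<le> 2 ^ l"
    using Y(3) by (simp add: I_def card_Pow finY)
  have f_in: "f j \<in> I" for j unfolding f_def I_def by blast
  have summ: "(\<Sum>p\<in>I. m p) = n"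
    unfolding m_def using card_eq_sum_fibres[of "{..<n}" I f] fin f_in by (metis card_lessThan finite_lessThan image_subsetI)
  have nI: "n \<ge> card I * (10 * L + 10)"
    by (rule le_trans[OF mult_le_mono1[OF cardI] n])
  from fibre_weights_exist[OF fin ne le_trans[OF cardI L] summ nI]
  obtain w where w: "(\<Sum>p\<in>I. w p) = r"
    and wle: "\<And>p. p \<in> I \<Longrightarrow> w p \<le> m p - w p"
    and wless: "\<And>p. p \<in> I \<Longrightarrow> m p > 0 \<Longrightarrow> w p < m p - w p"
    and wbin: "\<And>p N. p \<in> I \<Longrightarrow> m p \<le> N \<Longrightarrow> N \<ge> 1 \<Longrightarrow>
      (2::real) ^ m p \<le> 8 * 4 ^ L * sqrt N * real (m p choose w p)"
    unfolding r_def by blast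
  define \<S> where "\<S> = {S. S \<subseteq> {..<n} \<and> (\<forall>p\<in>I. card {j \<in> S. f j = p} = w p)}"
  have priv: "flip n x S \<in> hamming_ball n r x - (\<Union>y\<in>Y. hamming_ball n r y)" if "S \<in> \<S>" for S
  proof -
    have S: "S \<subseteq> {..<n}" and Sw: "\<And>p. p \<in> I \<Longrightarrow> card {j \<in> S. f j = p} = w p"
      using that unfolding \<S>_def by auto
    have finS: "finite S" using S finite_subset by blast
    have "{i \<in> {..<n}. x i \<noteq> flip n x S i} = S"
      using S unfolding flip_def by auto
    moreover have "card S = r"
      using card_eq_sum_fibres[OF finS fin, of f] f_in Sw w by (simp add: image_subset_iff)
    ultimately have dx: "hamming_dist n x (flip n x S) = r"
      unfolding hamming_dist_def by simp
    have dy: "hamming_dist n y (flip n x S) > r" if y: "y \<in> Y" for y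
    proof -
      \<comment> \<open>On a class \<open>p\<close> containing \<open>y\<close>, the words
        \<open>x\<close> and \<open>y\<close> disagree everywhere, so \<open>Z\<close> is the
        complement of \<open>S\<close> there; on the other classes \<open>Z\<close> coincides with
        \<open>S\<close>.\<close>
      define Z where "Z = {i \<in> {..<n}. y i \<noteq> flip n x S i}"
      have Z: "card {j \<in> Z. f j = p} = (if y \<in> p then m p - w p else w p)" if p: "p \<in> I" for p
      proof (cases "y \<in> p")
        case True
        have "{j \<in> Z. f j = p} = {j \<in> {..<n}. f j = p} - {j \<in> S. f j = p}"
          using True y unfolding Z_def flip_def f_def by auto
        also have "card \<dots> = m p - w p"
          unfolding m_def using S finS Sw[OF p] by (subst card_Diff_subset) auto
        finally show ?thesis using True by simp
      next
        case False
        have "{j \<in> Z. f j = p} = {j \<in> S. f j = p}"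
          using False y S unfolding Z_def flip_def f_def by auto
        then show ?thesis using False Sw[OF p] by simp
      qed
      \<comment> \<open>A coordinate separating \<open>y\<close> from \<open>x\<close> lies in a
        nonempty class containing \<open>y\<close>. This class makes the comparison of distances
        strict; the others give only \<open>\<le>\<close>.\<close>
      obtain j where j: "j < n" "y j \<noteq> x j"
      proof -
        have "y \<in> {..<n} \<rightarrow>\<^sub>E UNIV" "x \<in> {..<n} \<rightarrow>\<^sub>E UNIV"
          using x y Y(1) unfolding hamming_space_def by auto
        moreover have "y \<noteq> x" using y Y(2) by blast
        ultimately have "\<exists>j\<in>{..<n}. y j \<noteq> x j" using PiE_ext[of y "{..<n}" "\<lambda>_. UNIV" x] by blast
        then show ?thesis using that by auto
      qed
      have mj: "m (f j) > 0" unfolding m_def using j by (auto simp: card_gt_0_iff)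
      have "(\<Sum>p\<in>I. w p) < (\<Sum>p\<in>I. if y \<in> p then m p - w p else w p)"
      proof (rule sum_strict_mono_ex1[OF fin])
        show "\<forall>p\<in>I. w p \<le> (if y \<in> p then m p - w p else w p)" using wle by simp
        have "y \<in> f j" using y j unfolding f_def by simp
        then show "\<exists>p\<in>I. w p < (if y \<in> p then m p - w p else w p)"
          using wless[OF f_in mj] f_in by (intro bexI[of _ "f j"]) auto
      qed
      also have "\<dots> = card Z"
        using card_eq_sum_fibres[OF _ fin, of Z f] f_in Z by (simp add: Z_def image_subset_iff)
      finally show ?thesis unfolding hamming_dist_def Z_def w .
    qed
    show ?thesis
      using dx dy flip_in_hamming_space by (auto simp: hamming_ball_def not_le)
  qed
  define Q where "Q = hamming_ball n r x - (\<Union>y\<in>Y. hamming_ball n r y)"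
  have "finite Q"
    unfolding Q_def hamming_ball_def using finite_hamming_space by simp
  moreover have "flip n x ` \<S> \<subseteq> Q" using priv unfolding Q_def by blast
  moreover have "inj_on (flip n x) \<S>"
    using inj_on_flip by (rule inj_on_subset) (auto simp: \<S>_def)
  ultimately have card\<S>: "card \<S> \<le> card Q" by (metis card_inj_on_le)
  have n1: "n \<ge> 1" using n by (cases n) simp_all
  define c where "c = 8 * 4 ^ L * sqrt (real n)"
  \<comment> \<open>\<open>c \<ge> 1\<close> allows the exponent \<open>card I\<close> to be raised
    to \<open>2 ^ l\<close> below.\<close>
  have "1 \<le> (4::real) ^ L * sqrt n"
    using n1 mult_mono[of 1 "(4::real) ^ L" 1 "sqrt n"] by simp
  then have c1: "c \<ge> 1" unfolding c_def by simp
  have "(2::real) ^ n = (\<Prod>p\<in>I. 2 ^ m p)"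
    by (simp add: summ[symmetric] power_sum)
  also have "\<dots> \<le> (\<Prod>p\<in>I. c * real (m p choose w p))"
  proof (rule prod_mono, intro conjI)
    fix p assume p: "p \<in> I"
    have "m p \<le> n" unfolding summ[symmetric] using fin p by (intro member_le_sum) auto
    then show "(2::real) ^ m p \<le> c * real (m p choose w p)"
      unfolding c_def using wbin[OF p] n1 by blast
  qed simp
  also have "\<dots> = c ^ card I * real (\<Prod>p\<in>I. m p choose w p)"
    by (simp add: prod.distrib)
  also have "\<dots> \<le> c ^ 2 ^ l * real (card Q)"
  proof (rule mult_mono)
    show "c ^ card I \<le> c ^ 2 ^ l" using c1 cardI by (intro power_increasing)
    have "(\<Prod>p\<in>I. m p choose w p) \<le> card \<S>"
      unfolding \<S>_def m_def using fin by (intro card_subsets_by_fibres_ge) auto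
    then show "real (\<Prod>p\<in>I. m p choose w p) \<le> real (card Q)" using card\<S> by linarith
  qed (use c1 in \<open>auto intro: prod_nonneg\<close>)
  finally show ?thesis unfolding c_def Q_def r_def .
qed

section \<open>Greedy hitting sets\<close>

text \<open>Double counting of the pairs \<open>(u, S)\<close> with \<open>u \<in> S\<close>: an
  element of at least average degree has the required property.\<close>

lemma exists_popular_element:
  fixes \<delta> :: real
  assumes "finite U" "U \<noteq> {}" "finite R" "\<And>S. S \<in> R \<Longrightarrow> S \<subseteq> U \<and> \<delta> * card U \<le> card S"
  shows "\<exists>u\<in>U. \<delta> * card R \<le> card {S \<in> R. u \<in> S}"
proof (rule ccontr)
  assume "\<not> ?thesis"
  then have "(\<Sum>u\<in>U. real (card {S \<in> R. u \<in> S})) < (\<Sum>u\<in>U. \<delta> * card R)"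
    using assms by (intro sum_strict_mono) (auto simp: not_le)
  also have "\<dots> = (\<Sum>S\<in>R. \<delta> * card U)" by simp
  also have "\<dots> \<le> (\<Sum>S\<in>R. real (card S))" using assms by (intro sum_mono) auto
  also have "\<dots> = (\<Sum>S\<in>R. real (card {u \<in> U. u \<in> S}))"
  proof (rule sum.cong)
    fix S assume "S \<in> R"
    then have "{u \<in> U. u \<in> S} = S" using assms(4) by blast
    then show "real (card S) = real (card {u \<in> U. u \<in> S})" by simp
  qed simp
  also have "\<dots> = (\<Sum>u\<in>U. real (card {S \<in> R. u \<in> S}))"
    using sum_multicount_gen[OF assms(3,1), of "\<lambda>S u. u \<in> S" "\<lambda>u. card {S \<in> R. u \<in> S}"]
    by (simp add: of_nat_sum[symmetric] del: of_nat_sum)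
  finally show False by simp
qed

text \<open>Adding an element popular among the sets not yet hit multiplies their number by at most
  \<open>1 - \<delta>\<close>.\<close>

lemma greedy_partial_hitting_set:
  fixes \<delta> :: real
  assumes U: "finite U" "U \<noteq> {}" and F: "finite F"
    and large: "\<And>S. S \<in> F \<Longrightarrow> S \<subseteq> U \<and> \<delta> * card U \<le> card S" and "\<delta> \<le> 1"
  shows "\<exists>C\<subseteq>U. card C \<le> k \<and> card {S \<in> F. S \<inter> C = {}} \<le> (1 - \<delta>) ^ k * card F"
proof (induction k)
  case 0
  show ?case by (intro exI[of _ "{}"]) simp
next
  case (Suc k)
  then obtain C where C: "C \<subseteq> U" "card C \<le> k"
    and le: "card {S \<in> F. S \<inter> C = {}} \<le> (1 - \<delta>) ^ k * card F" by blast
  define R where "R = {S \<in> F. S \<inter> C = {}}"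
  have finR: "finite R" using F unfolding R_def by simp
  obtain u where u: "u \<in> U" "\<delta> * card R \<le> card {S \<in> R. u \<in> S}"
    using exists_popular_element[OF U finR, of \<delta>] large unfolding R_def by blast
  have "{S \<in> F. S \<inter> insert u C = {}} = R - {S \<in> R. u \<in> S}" unfolding R_def by auto
  also have "card \<dots> = card R - card {S \<in> R. u \<in> S}"
    using finR by (intro card_Diff_subset) auto
  also have "real \<dots> = real (card R) - card {S \<in> R. u \<in> S}"
    using finR by (intro of_nat_diff card_mono) auto
  also have "\<dots> \<le> (1 - \<delta>) * card R" using u by (simp add: algebra_simps)
  also have "\<dots> \<le> (1 - \<delta>) * ((1 - \<delta>) ^ k * card F)"
    using le \<open>\<delta> \<le> 1\<close> unfolding R_def by (intro mult_left_mono) auto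
  finally have "card {S \<in> F. S \<inter> insert u C = {}} \<le> (1 - \<delta>) ^ Suc k * card F" by simp
  moreover have "card (insert u C) \<le> Suc k"
    using C card_insert_le_m1[of "Suc k" C u] by simp
  ultimately show ?case using C u by blast
qed

text \<open>After \<open>k > M / \<delta>\<close> greedy steps at most
  \<open>exp (M - \<delta> * k) < 1\<close> sets remain unhit, hence none. The successor of the
  floor makes the inequality for \<open>k\<close> strict.\<close>

lemma exists_small_hitting_set:
  fixes \<delta> M :: real
  assumes U: "finite U" "U \<noteq> {}" and F: "finite F"
    and large: "\<And>S. S \<in> F \<Longrightarrow> S \<subseteq> U \<and> \<delta> * card U \<le> card S"
    and \<delta>: "0 < \<delta>" "\<delta> \<le> 1" and M: "card F \<le> exp M" "M \<ge> 0"
  shows "\<exists>C\<subseteq>U. card C \<le> M / \<delta> + 1 \<and> (\<forall>S\<in>F. S \<inter> C \<noteq> {})"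
proof -
  define k where "k = Suc (nat \<lfloor>M / \<delta>\<rfloor>)"
  have "real k = of_int \<lfloor>M / \<delta>\<rfloor> + 1" using M \<delta> unfolding k_def by simp
  then have k: "real k \<le> M / \<delta> + 1" "M / \<delta> < real k" by linarith+
  obtain C where C: "C \<subseteq> U" "card C \<le> k"
    and le: "card {S \<in> F. S \<inter> C = {}} \<le> (1 - \<delta>) ^ k * card F"
    using greedy_partial_hitting_set[OF U F large \<delta>(2), of k] by blast
  have "(1 - \<delta>) ^ k \<le> exp (- \<delta>) ^ k"
    using \<delta> exp_ge_add_one_self[of "- \<delta>"] by (intro power_mono) auto
  also have "\<dots> = exp (- (\<delta> * k))" by (simp add: exp_of_nat_mult[symmetric] mult.commute)
  finally have "(1 - \<delta>) ^ k * card F \<le> exp (- (\<delta> * k)) * exp M"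
    using M \<delta> by (intro mult_mono) auto
  also have "\<dots> = exp (M - \<delta> * k)" by (simp add: exp_add[symmetric])
  also have "\<dots> < 1" using k \<delta> by (simp add: field_simps)
  finally have "card {S \<in> F. S \<inter> C = {}} = 0" using le by linarith
  then have "{S \<in> F. S \<inter> C = {}} = {}" using F by simp
  then have "\<forall>S\<in>F. S \<inter> C \<noteq> {}" by blast
  moreover have "card C \<le> M / \<delta> + 1" using C k by linarith
  ultimately show ?thesis using C by blast
qed

text \<open>Each such subset is the set of entries of a list of length at most \<open>l\<close>; the
  resulting geometric sum is at most the next power because \<open>card A \<ge> 2\<close>.\<close>

lemma card_small_subsets_le:
  assumes "finite A" "card A \<ge> 2"
  shows "finite {Y. Y \<subseteq> A \<and> card Y \<le> l}" "card {Y. Y \<subseteq> A \<and> card Y \<le> l} \<le> card A ^ Suc l"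
proof -
  let ?X = "{xs. set xs \<subseteq> A \<and> length xs \<le> l}"
  show "finite {Y. Y \<subseteq> A \<and> card Y \<le> l}" using assms by simp
  have "{Y. Y \<subseteq> A \<and> card Y \<le> l} \<subseteq> set ` ?X"
  proof
    fix Y assume Y: "Y \<in> {Y. Y \<subseteq> A \<and> card Y \<le> l}"
    then obtain xs where "set xs = Y" "distinct xs"
      using finite_distinct_list[of Y] finite_subset[of Y A] assms by auto
    then show "Y \<in> set ` ?X" using Y by (intro image_eqI[of _ _ xs]) (auto simp: distinct_card)
  qed
  then have "card {Y. Y \<subseteq> A \<and> card Y \<le> l} \<le> card ?X"
    using finite_lists_length_le[OF assms(1)] by (meson surj_card_le)
  also have "\<dots> = (\<Sum>i\<le>l. card A ^ i)" using assms by (simp add: card_lists_length_le)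
  also have "\<dots> \<le> card A ^ Suc l"
  proof (induction l)
    case 0
    show ?case using assms by simp
  next
    case (Suc l)
    have "(\<Sum>i\<le>Suc l. card A ^ i) \<le> 2 * card A ^ Suc l" using Suc by simp
    also have "\<dots> \<le> card A * card A ^ Suc l" using assms by (intro mult_right_mono) auto
    finally show ?case by simp
  qed
  finally show "card {Y. Y \<subseteq> A \<and> card Y \<le> l} \<le> card A ^ Suc l" .
qed

section \<open>Identifying codes\<close>

text \<open>If \<open>X \<noteq> Y\<close>, one of them has an element \<open>x\<close> outside the
  other. A codeword covered by \<open>x\<close> and by no word of the other set separates the
  two.\<close>

lemma identifyingI:
  assumes C: "C \<subseteq> hamming_space n"
    and hit: "\<And>x Y. x \<in> hamming_space n \<Longrightarrow> Y \<subseteq> hamming_space n \<Longrightarrow> card Y \<le> l \<Longrightarrow> x \<notin> Y \<Longrightarrow>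
      (hamming_ball n r x - (\<Union>y\<in>Y. hamming_ball n r y)) \<inter> C \<noteq> {}"
  shows "identifying n r l C"
proof -
  have neq: "I_set n r C X \<noteq> I_set n r C Y"
    if XY: "X \<subseteq> hamming_space n" "Y \<subseteq> hamming_space n" "card Y \<le> l" "\<not> X \<subseteq> Y" for X Y
  proof -
    obtain x where x: "x \<in> X" "x \<notin> Y" using XY by blast
    then have "x \<in> hamming_space n" using XY by blast
    from hit[OF this XY(2,3) x(2)] obtain z
      where "z \<in> hamming_ball n r x" "z \<notin> (\<Union>y\<in>Y. hamming_ball n r y)" "z \<in> C" by blast
    then have "z \<in> I_set n r C X" "z \<notin> I_set n r C Y" using x unfolding I_set_def by auto
    then show ?thesis by blast
  qed
  \<comment> \<open>Any word together with \<open>Y = {}\<close> shows that \<open>C\<close> is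
    nonempty.\<close>
  have "(\<lambda>j\<in>{..<n}. True) \<in> hamming_space n" unfolding hamming_space_def by simp
  from hit[OF this, of "{}"] have "C \<noteq> {}" by auto
  moreover have "I_set n r C X \<noteq> I_set n r C Y"
    if "X \<subseteq> hamming_space n" "Y \<subseteq> hamming_space n" "card X \<le> l" "card Y \<le> l" "X \<noteq> Y" for X Y
  proof (cases "X \<subseteq> Y")
    case True
    then have "\<not> Y \<subseteq> X" using that by blast
    then show ?thesis using neq[of Y X] that by simp
  qed (use neq that in simp)
  ultimately show ?thesis
    unfolding identifying_def is_code_def using C by simp
qed

text \<open>The sets to be hit have density at least \<open>1 / c\<close>, and there are at most
  \<open>exp (n * (l + 2))\<close> of them, so the greedy bound is
  \<open>n * (l + 2) * c + 1\<close>.\<close>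

lemma exists_identifying_code:
  assumes L: "L \<ge> 2 ^ l" and n: "n \<ge> 2 ^ l * (10 * L + 10)"
  shows "\<exists>C. identifying n (n div 2 - L) l C
    \<and> card C \<le> real (l + 3) * real n * (8 * 4 ^ L * sqrt n) ^ 2 ^ l"
proof -
  define r where "r = n div 2 - L"
  define H where "H = hamming_space n"
  define q where "q = (\<lambda>(x, Y). hamming_ball n r x - (\<Union>y\<in>Y. hamming_ball n r y))"
  define \<Y> where "\<Y> = {Y. Y \<subseteq> H \<and> card Y \<le> l}"
  define P where "P = {(x, Y). x \<in> H \<and> Y \<in> \<Y> \<and> x \<notin> Y}"
  define c where "c = (8 * 4 ^ L * sqrt (real n)) ^ 2 ^ l"
  have n1: "n \<ge> 1" using n by (cases n) simp_all
  have "1 \<le> (4::real) ^ L * sqrt n"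
    using n1 mult_mono[of 1 "(4::real) ^ L" 1 "sqrt n"] by simp
  then have c1: "c \<ge> 1" unfolding c_def by (intro one_le_power) simp
  have finH: "finite H" and cardH: "card H = 2 ^ n"
    unfolding H_def by (rule finite_hamming_space, rule card_hamming_space)
  have "card H \<ge> 2" using n1 power_increasing[of 1 n "2::nat"] by (simp add: cardH)
  note sub = card_small_subsets_le[OF finH this, of l, folded \<Y>_def]
  have Psub: "P \<subseteq> H \<times> \<Y>" unfolding P_def by blast
  have finP: "finite P" by (rule finite_subset[OF Psub finite_cartesian_product[OF finH sub(1)]])
  \<comment> \<open>One factor \<open>2 ^ n\<close> counts \<open>x\<close>, and
    \<open>l + 1\<close> further ones bound the choices of \<open>Y\<close>.\<close>
  have "card P \<le> card (H \<times> \<Y>)" using Psub finH sub(1) by (intro card_mono) auto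
  also have "\<dots> \<le> card H * card H ^ Suc l" unfolding card_cartesian_product
    using sub(2) by (rule mult_le_mono2)
  also have "\<dots> = 2 ^ (n * (l + 2))"
    by (simp add: cardH power_mult[symmetric] power_add[symmetric])
  finally have "card P \<le> 2 ^ (n * (l + 2))" .
  then have "card (q ` P) \<le> 2 ^ (n * (l + 2))"
    by (rule le_trans[OF card_image_le[OF finP]])
  then have "real (card (q ` P)) \<le> real (2 ^ (n * (l + 2)))" by (simp only: of_nat_le_iff)
  also have "\<dots> = 2 ^ (n * (l + 2))" by simp
  also have "\<dots> \<le> exp 1 ^ (n * (l + 2))"
    using exp_ge_add_one_self[of 1] by (intro power_mono) auto
  also have "\<dots> = exp (real (n * (l + 2)))" using exp_of_nat_mult[of "n * (l + 2)" "1::real"] by simp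
  finally have cardF: "real (card (q ` P)) \<le> exp (real (n * (l + 2)))" .
  have large: "S \<subseteq> H \<and> (1 / c) * card H \<le> card S" if S: "S \<in> q ` P" for S
  proof -
    obtain x Y where xY: "S = q (x, Y)" "x \<in> H" "Y \<subseteq> H" "card Y \<le> l" "x \<notin> Y"
      using S unfolding P_def \<Y>_def by auto
    have "(2::real) ^ n \<le> c * card S"
      using card_private_neighbours_ge[OF xY(2,3)[unfolded H_def] xY(5,4) L n]
      unfolding xY(1) c_def q_def r_def prod.case .
    then have "(1 / c) * card H \<le> card S"
      using c1 by (simp add: cardH field_simps)
    moreover have "S \<subseteq> H" using xY unfolding q_def H_def hamming_ball_def by auto
    ultimately show ?thesis by blast
  qed
  have "H \<noteq> {}" using \<open>card H \<ge> 2\<close> by auto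
  have "0 < 1 / c" "1 / c \<le> 1" using c1 by simp_all
  note hit = exists_small_hitting_set[OF finH \<open>H \<noteq> {}\<close> finite_imageI[OF finP] large this cardF]
  have "\<exists>C\<subseteq>H. card C \<le> real (n * (l + 2)) / (1 / c) + 1 \<and> (\<forall>S\<in>q ` P. S \<inter> C \<noteq> {})"
    by (rule hit) simp_all
  then obtain C where C: "C \<subseteq> H" "card C \<le> real (n * (l + 2)) / (1 / c) + 1"
    "\<forall>S\<in>q ` P. S \<inter> C \<noteq> {}" by (elim exE conjE)
  have "identifying n r l C"
  proof (rule identifyingI)
    fix x Y assume "x \<in> hamming_space n" "Y \<subseteq> hamming_space n" "card Y \<le> l" "x \<notin> Y"
    then have "(x, Y) \<in> P" unfolding P_def \<Y>_def H_def by simp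
    then have "q (x, Y) \<in> q ` P" by (rule imageI)
    with C(3) have "q (x, Y) \<inter> C \<noteq> {}" by (rule bspec)
    then show "(hamming_ball n r x - (\<Union>y\<in>Y. hamming_ball n r y)) \<inter> C \<noteq> {}"
      by (simp only: q_def prod.case not_False_eq_True)
  qed (use C H_def in simp)
  moreover have "card C \<le> real (l + 3) * real n * c"
  proof -
    \<comment> \<open>The additive 1 is absorbed into one more copy of \<open>n * c\<close>, turning
      \<open>l + 2\<close> into \<open>l + 3\<close>.\<close>
    have "1 \<le> real n * c" using n1 c1 mult_mono[of 1 "real n" 1 c] by simp
    moreover have "real (n * (l + 2)) / (1 / c) = real (l + 2) * (real n * c)" by (simp add: algebra_simps)
    moreover have "real (l + 3) * real n * c = real (l + 2) * (real n * c) + real n * c"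
      by (simp add: algebra_simps)
    ultimately show ?thesis using C(2) by linarith
  qed
  ultimately show ?thesis unfolding c_def r_def by (intro exI[of _ C] conjI)
qed

text \<open>Requiring \<open>n0 \<ge> 2 * L\<close> makes the natural-number subtraction in the
  radius agree with the integer one.\<close>

theorem theorem5:
  fixes l L :: nat
  assumes "l \<ge> 1" and "L \<ge> 2 ^ l"
  shows "\<exists>(n0::nat) (A::real). n0 \<ge> 2 * L \<and>
    (\<forall>n\<ge>n0. ereal_of_enat (min_identifying (n div 2 - L) l n)
              \<le> ereal (A * real n ^ (2 ^ (l - 1) + 1)))"
proof (intro exI conjI allI impI)
  let ?n0 = "2 ^ l * (10 * L + 10)"
  let ?A = "real (l + 3) * (8 * 4 ^ L) ^ 2 ^ l"
  have "1 * (10 * L + 10) \<le> ?n0" by (intro mult_le_mono1) simp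
  then show "2 * L \<le> ?n0" by (rule le_trans[rotated]) simp
  fix n assume "?n0 \<le> n"
  from exists_identifying_code[OF assms(2) this]
  obtain C where C: "identifying n (n div 2 - L) l C"
    "card C \<le> real (l + 3) * real n * (8 * 4 ^ L * sqrt n) ^ 2 ^ l"
    by (elim exE conjE)
  \<comment> \<open>Here \<open>l \<ge> 1\<close> enters: the \<open>2 ^ l\<close> factors
    \<open>sqrt n\<close> pair up into \<open>2 ^ (l - 1)\<close> factors \<open>n\<close>, and the
    remaining factor \<open>n\<close> comes from the greedy choice.\<close>
  have "(2::nat) ^ l = 2 * 2 ^ (l - 1)"
    using assms(1) by (cases l) auto
  then have "sqrt n ^ 2 ^ l = (sqrt n ^ 2) ^ 2 ^ (l - 1)"
    by (simp only: power_mult)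
  also have "\<dots> = real n ^ 2 ^ (l - 1)" by simp
  finally have "real (l + 3) * real n * (8 * 4 ^ L * sqrt n) ^ 2 ^ l
      = real (l + 3) * real n * ((8 * 4 ^ L) ^ 2 ^ l * real n ^ 2 ^ (l - 1))"
    by (simp only: power_mult_distrib)
  also have "\<dots> = ?A * real n ^ (2 ^ (l - 1) + 1)" by (simp only: power_add power_one_right mult_ac)
  finally have eq: "real (l + 3) * real n * (8 * 4 ^ L * sqrt n) ^ 2 ^ l = ?A * real n ^ (2 ^ (l - 1) + 1)" .
  have "card C \<le> ?A * real n ^ (2 ^ (l - 1) + 1)" using C(2) unfolding eq .
  with C(1) show "ereal_of_enat (min_identifying (n div 2 - L) l n)
      \<le> ereal (?A * real n ^ (2 ^ (l - 1) + 1))"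
    unfolding min_identifying_le_iff by (intro exI[of _ C] conjI)
qed

end
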